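(* Let $S$ be a finite subset of a real Hilbert space $\mathcal{H}$, let $S_1,\dots,S_m$ be a partition of $S$, and let $$D=\sup_{i\in\{1,\dots,m\}}\ \sup_{\omega,\omega'\in S_i}\|\omega-\omega'\|.$$ Let $\omega^*=\sum_{\omega\in S}\alpha^*(\omega)\,\omega\in\mathrm{co}(S)$ with weight function $\alpha^*$. Construct a random $\tilde\omega\in\mathrm{co}(S)$ as follows: (1) for each $i\in\{1,\dots,m\}$, sample (independently, with replacement, and independently across $i$) $n_i=\lceil\alpha^*(S_i)\,m\rceil$ elements $\omega_{i,1},\dots,\omega_{i,n_i}$ of $S_i$, each element $\omega\in S_i$ being drawn with probability proportional to $\alpha^*(\omega)$, and set $\tilde\omega_i=\frac1{n_i}\sum_{j=1}^{n_i}\omega_{i,j}$; (2) set $\tilde\omega=\sum_{i=1}^m\alpha^*(S_i)\,\tilde\omega_i$. Then $\tilde\omega$ is at most $2m$-sparse. Furthermore, for every $\delta\in(0,1)$, with probability at least $1-\delta$, $$\|\omega^*-\tilde\omega\|\le D\left(\frac1{\sqrt m}+\sqrt{\frac{\log(1/\delta)}{m}}\right).$$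
   Context: $\mathrm{co}(S)=\{\sum_{\omega\in S}\alpha(\omega)\omega:\alpha:S\to[0,\infty),\ \sum_{\omega\in S}\alpha(\omega)=1\}$ is the convex hull of $S$; the function $\alpha$ is the weight function of the element. For $S'\subseteq S$, $\alpha(S')=\sum_{\omega\in S'}\alpha(\omega)$. An element of $\mathrm{co}(S)$ is at most $k$-sparse if it has a weight function with at most $k$ non-zero entries. Indices $i$ with $\alpha^*(S_i)=0$ (for which $n_i=0$) contribute $0$ to the sum defining $\tilde\omega$. *)

theory Defs
  imports "HOL-Probability.Probability" "HOL-Probability.Product_PMF"
begin

definition weight_function :: "'a::real_vector set \<Rightarrow> ('a \<Rightarrow> real) \<Rightarrow> 'a \<Rightarrow> bool" where
  "weight_function S \<alpha> x \<longleftrightarrow>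
     (\<forall>\<omega>\<in>S. 0 \<le> \<alpha> \<omega>) \<and> (\<Sum>\<omega>\<in>S. \<alpha> \<omega>) = 1 \<and> x = (\<Sum>\<omega>\<in>S. \<alpha> \<omega> *\<^sub>R \<omega>)"

lemma convex_hull_iff_weight_function:
  assumes "finite S"
  shows "x \<in> convex hull S \<longleftrightarrow> (\<exists>\<alpha>. weight_function S \<alpha> x)"
  using assms by (auto simp: convex_hull_finite weight_function_def)

definition at_most_sparse :: "nat \<Rightarrow> 'a::real_vector set \<Rightarrow> 'a \<Rightarrow> bool" where
  "at_most_sparse k S x \<longleftrightarrow> x \<in> convex hull S \<and>
     (\<exists>\<alpha>. weight_function S \<alpha> x \<and> card {\<omega> \<in> S. \<alpha> \<omega> \<noteq> 0} \<le> k)"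

definition max_diameter :: "nat \<Rightarrow> (nat \<Rightarrow> 'a::real_normed_vector set) \<Rightarrow> real" where
  "max_diameter m P =
     (SUP i\<in>{1..m}. SUP (\<omega>, \<omega>') \<in> P i \<times> P i. norm (\<omega> - \<omega>'))"

definition sample_size :: "('a \<Rightarrow> real) \<Rightarrow> nat \<Rightarrow> 'a set \<Rightarrow> nat" where
  "sample_size \<alpha> m A = nat \<lceil>sum \<alpha> A * real m\<rceil>"

text \<open>A single draw from \<open>A\<close> with probabilities proportional to \<open>\<alpha>\<close>. The
  definition is meaningful only if \<open>sum \<alpha> A > 0\<close>; a part of weight zero has
  sample size zero, so its draw distribution never enters the construction below.\<close>

definition draw_pmf :: "('a \<Rightarrow> real) \<Rightarrow> 'a set \<Rightarrow> 'a pmf" where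
  "draw_pmf \<alpha> A = embed_pmf (\<lambda>\<omega>. if \<omega> \<in> A then \<alpha> \<omega> / sum \<alpha> A else 0)"

lemma pmf_draw_pmf:
  assumes "finite A" "\<And>\<omega>. \<omega> \<in> A \<Longrightarrow> 0 \<le> \<alpha> \<omega>" "sum \<alpha> A > 0"
  shows "pmf (draw_pmf \<alpha> A) \<omega> = (if \<omega> \<in> A then \<alpha> \<omega> / sum \<alpha> A else 0)"
  unfolding draw_pmf_def
proof (rule pmf_embed_pmf)
  let ?f = "\<lambda>\<omega>. if \<omega> \<in> A then \<alpha> \<omega> / sum \<alpha> A else 0"
  show "0 \<le> ?f x" for x using assms by auto
  have "(\<integral>\<^sup>+x. ennreal (?f x) \<partial>count_space UNIV)
      = (\<integral>\<^sup>+x. ennreal (\<alpha> x / sum \<alpha> A) \<partial>count_space A)"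
    by (subst nn_integral_count_space_indicator, simp)
       (auto intro!: nn_integral_cong simp: indicator_def)
  also have "\<dots> = (\<Sum>x\<in>A. ennreal (\<alpha> x / sum \<alpha> A))"
    using assms(1) by (rule nn_integral_count_space_finite)
  also have "\<dots> = ennreal (\<Sum>x\<in>A. \<alpha> x / sum \<alpha> A)"
    using assms by (intro sum_ennreal) auto
  also have "(\<Sum>x\<in>A. \<alpha> x / sum \<alpha> A) = 1"
    using assms(3) by (simp flip: sum_divide_distrib)
  finally show "(\<integral>\<^sup>+x. ennreal (?f x) \<partial>count_space UNIV) = 1" by simp
qed

text \<open>The joint law of all draws: the product measure makes the coordinates
  \<open>(i, j)\<close> independent, both within a part and across parts. The value \<open>0\<close>
  is assigned outside the finite index set and is never read.\<close>

definition draws_pmf ::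
    "('a::zero \<Rightarrow> real) \<Rightarrow> nat \<Rightarrow> (nat \<Rightarrow> 'a set) \<Rightarrow> (nat \<times> nat \<Rightarrow> 'a) pmf" where
  "draws_pmf \<alpha> m P =
     Pi_pmf (SIGMA i:{1..m}. {1..sample_size \<alpha> m (P i)}) 0 (\<lambda>(i, j). draw_pmf \<alpha> (P i))"

text \<open>If the sample size is zero, both the factor \<open>1 / 0\<close> and the empty sum are
  zero, so such a part contributes nothing to the combined point.\<close>

definition part_mean ::
    "('a::real_vector \<Rightarrow> real) \<Rightarrow> nat \<Rightarrow> (nat \<Rightarrow> 'a set) \<Rightarrow> (nat \<times> nat \<Rightarrow> 'a) \<Rightarrow> nat \<Rightarrow> 'a" where
  "part_mean \<alpha> m P w i =
     (1 / real (sample_size \<alpha> m (P i))) *\<^sub>R (\<Sum>j=1..sample_size \<alpha> m (P i). w (i, j))"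

definition combined_point ::
    "('a::real_vector \<Rightarrow> real) \<Rightarrow> nat \<Rightarrow> (nat \<Rightarrow> 'a set) \<Rightarrow> (nat \<times> nat \<Rightarrow> 'a) \<Rightarrow> 'a" where
  "combined_point \<alpha> m P w = (\<Sum>i=1..m. sum \<alpha> (P i) *\<^sub>R part_mean \<alpha> m P w i)"

definition random_point ::
    "('a::real_vector \<Rightarrow> real) \<Rightarrow> nat \<Rightarrow> (nat \<Rightarrow> 'a set) \<Rightarrow> 'a pmf" where
  "random_point \<alpha> m P = map_pmf (combined_point \<alpha> m P) (draws_pmf \<alpha> m P)"

end

theory Submission imports Defs begin

text \<open>
  The error \<open>\<omega>t - \<omega>s\<close> is a sum of independent centred vectors, one for each draw \<open>(i, j)\<close>, of norm
  at most \<open>D \<alpha>(S\<^sub>i) / n\<^sub>i\<close>. Since \<open>n\<^sub>i \<ge> \<alpha>(S\<^sub>i) m\<close>, the squares of these bounds add up to at most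
  \<open>D\<^sup>2 / m\<close>. Orthogonality then bounds the second moment of the norm of the error, hence its mean by
  \<open>D / sqrt m\<close>. Replacing one draw changes the norm by at most \<open>D \<alpha>(S\<^sub>i) / n\<^sub>i\<close>, so McDiarmid's inequality
  controls the fluctuation around the mean, with failure probability \<open>\<delta>\<^sup>2 \<le> \<delta>\<close>.
  McDiarmid's inequality is proved by integrating out one coordinate at a time and applying
  Hoeffding's lemma to the resulting conditional expectation.
\<close>

subsection \<open>Concentration for finite products\<close>

lemma finite_set_Pi_pmf:
  assumes "finite I" "\<And>k. k \<in> I \<Longrightarrow> finite (set_pmf (p k))"
  shows "finite (set_pmf (Pi_pmf I d p))"
  using assms by (auto simp: set_Pi_pmf)

text \<open>Fubini for a single coordinate: finite supports reduce the integrals to finite sums. It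
  drives the inductions for the exponential moment and for the second moment.\<close>

lemma expectation_Pi_pmf_insert:
  fixes f :: "_ \<Rightarrow> real"
  assumes "finite I" "x \<notin> I" "\<And>k. k \<in> insert x I \<Longrightarrow> finite (set_pmf (p k))"
  shows "measure_pmf.expectation (Pi_pmf (insert x I) d p) f =
    measure_pmf.expectation (p x)
      (\<lambda>y. measure_pmf.expectation (Pi_pmf I d p) (\<lambda>w. f (w(x := y))))"
proof -
  have "Pi_pmf (insert x I) d p = p x \<bind> (\<lambda>y. map_pmf (\<lambda>w. w(x := y)) (Pi_pmf I d p))"
    using assms by (simp add: Pi_pmf_insert' map_pmf_def)
  moreover have "finite (set_pmf (Pi_pmf I d p))" "finite (set_pmf (p x))"
    using assms by (auto intro!: finite_set_Pi_pmf)
  ultimately show ?thesis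
    by (simp add: pmf_expectation_bind[of "set_pmf (p x)"] integral_measure_pmf[of "set_pmf (p x)"])
qed

text \<open>Bounded differences are assumed only on the support, so filling in a coordinate must not
  leave it.\<close>

lemma set_Pi_pmf_insert_upd:
  assumes "finite I" "w \<in> set_pmf (Pi_pmf I d p)" "y \<in> set_pmf (p x)"
  shows "w(x := y) \<in> set_pmf (Pi_pmf (insert x I) d p)"
  using assms by (auto simp: set_Pi_pmf PiE_dflt_def)

text \<open>With coordinate \<open>x\<close> frozen at \<open>y\<close>, the induction hypothesis
  handles the fluctuation of \<open>f\<close> around its conditional mean \<open>g y\<close>, and
  Hoeffding's lemma handles that of \<open>g\<close> around its own mean. The two exponents
  add.\<close>

lemma bounded_differences_mgf:
  fixes f :: "('i \<Rightarrow> 'b) \<Rightarrow> real" and c :: "'i \<Rightarrow> real"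
  assumes "finite I" "\<And>k. k \<in> I \<Longrightarrow> finite (set_pmf (p k))" and l: "0 < l"
    and "\<And>k w y. k \<in> I \<Longrightarrow> w \<in> set_pmf (Pi_pmf I d p) \<Longrightarrow> y \<in> set_pmf (p k) \<Longrightarrow>
      \<bar>f w - f (w(k := y))\<bar> \<le> c k"
  shows "measure_pmf.expectation (Pi_pmf I d p)
      (\<lambda>w. exp (l * (f w - measure_pmf.expectation (Pi_pmf I d p) f)))
    \<le> exp (l\<^sup>2 * (\<Sum>k\<in>I. (c k)\<^sup>2) / 8)"
  using assms(1,2,4)
proof (induction I arbitrary: f rule: finite_induct)
  case empty
  then show ?case by simp
next
  case (insert x A)
  let ?E = "measure_pmf.expectation (Pi_pmf A d p)"
  let ?Ex = "measure_pmf.expectation (p x)"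
  have fin: "finite (set_pmf (Pi_pmf A d p))" "finite (set_pmf (p x))"
    using insert by (auto intro!: finite_set_Pi_pmf)
  note int = integrable_measure_pmf_finite[OF fin(1)] integrable_measure_pmf_finite[OF fin(2)]
  define g where "g y = ?E (\<lambda>w. f (w(x := y)))" for y
  let ?S = "\<Sum>k\<in>A. (c k)\<^sup>2"
  have Ef: "measure_pmf.expectation (Pi_pmf (insert x A) d p) h =
    ?Ex (\<lambda>y. ?E (\<lambda>w. h (w(x := y))))" for h :: "_ \<Rightarrow> real"
    using insert by (intro expectation_Pi_pmf_insert) auto
  have IH: "?E (\<lambda>w. exp (l * (f (w(x := y)) - g y))) \<le> exp (l\<^sup>2 * ?S / 8)"
    if y: "y \<in> set_pmf (p x)" for y
    unfolding g_def
  proof (rule insert.IH)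
    fix k w z assume k: "k \<in> A" and w: "w \<in> set_pmf (Pi_pmf A d p)" and z: "z \<in> set_pmf (p k)"
    have "k \<noteq> x" using k insert by auto
    \<comment> \<open>Updates at distinct coordinates commute, so a change at \<open>k\<close> after
      freezing \<open>x\<close> is a change at \<open>k\<close> in the larger product.\<close>
    then have "(w(k := z))(x := y) = (w(x := y))(k := z)"
      by (rule fun_upd_twist)
    then show "\<bar>f (w(x := y)) - f ((w(k := z))(x := y))\<bar> \<le> c k"
      using insert.prems(2)[OF _ set_Pi_pmf_insert_upd[OF insert(1) w y] z] k by (simp del: fun_upd_apply)
  qed (use insert in auto)
  have gdiff: "g y - g z \<le> c x" if "y \<in> set_pmf (p x)" "z \<in> set_pmf (p x)" for y z
  proof -
    have "g y - g z = ?E (\<lambda>w. f (w(x := y)) - f (w(x := z)))"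
      unfolding g_def by (simp add: int)
    also have "\<dots> \<le> ?E (\<lambda>_. c x)"
    proof (rule integral_mono_AE)
      have "f (w(x := y)) - f (w(x := z)) \<le> c x" if "w \<in> set_pmf (Pi_pmf A d p)" for w
        using insert.prems(2)[OF _ set_Pi_pmf_insert_upd[OF insert(1) that \<open>y \<in> _\<close>] \<open>z \<in> _\<close>]
        by (simp add: abs_le_iff del: fun_upd_apply)
      then show "AE w in measure_pmf (Pi_pmf A d p). f (w(x := y)) - f (w(x := z)) \<le> c x"
        by (simp add: AE_measure_pmf_iff)
    qed (auto intro: int)
    finally show ?thesis by simp
  qed
  \<comment> \<open>The extreme values are attained on the finite support, so \<open>b - a\<close>
    is itself a difference \<open>g y - g z\<close> and at most \<open>c x\<close>.\<close>
  define a where "a = Min (g ` set_pmf (p x))"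
  define b where "b = Max (g ` set_pmf (p x))"
  have "a \<in> g ` set_pmf (p x)" "b \<in> g ` set_pmf (p x)"
    unfolding a_def b_def using fin by (auto intro!: Min_in Max_in simp: set_pmf_not_empty)
  moreover have ab: "a \<le> b"
    unfolding a_def b_def using fin by (auto simp: set_pmf_not_empty)
  ultimately have ba: "(b - a)\<^sup>2 \<le> (c x)\<^sup>2"
    using gdiff by (intro power_mono) auto
  interpret interval_bounded_random_variable "measure_pmf (p x)" g a b
    by unfold_locales (use fin in \<open>auto simp: AE_measure_pmf_iff a_def b_def\<close>)
  have "ennreal (?Ex (\<lambda>y. exp (l * (g y - ?Ex g)))) \<le> ennreal (exp (l\<^sup>2 * (b - a)\<^sup>2 / 8))"
    using Hoeffdings_lemma_nn_integral[OF l] by (subst nn_integral_eq_integral[symmetric]) (auto intro: int)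
  then have "?Ex (\<lambda>y. exp (l * (g y - ?Ex g))) \<le> exp (l\<^sup>2 * (b - a)\<^sup>2 / 8)"
    by simp
  also have "\<dots> \<le> exp (l\<^sup>2 * (c x)\<^sup>2 / 8)"
    using ba by (simp add: mult_left_mono)
  finally have H: "?Ex (\<lambda>y. exp (l * (g y - ?Ex g))) \<le> exp (l\<^sup>2 * (c x)\<^sup>2 / 8)" .
  \<comment> \<open>Insert \<open>g y\<close> in the exponent; the factor with
    \<open>g y - ?Ex g\<close> does not depend on \<open>w\<close> and leaves the inner
    expectation.\<close>
  have "?Ex (\<lambda>y. ?E (\<lambda>w. exp (l * (f (w(x := y)) - ?Ex g))))
      = ?Ex (\<lambda>y. exp (l * (g y - ?Ex g)) * ?E (\<lambda>w. exp (l * (f (w(x := y)) - g y))))"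
    by (simp flip: integral_mult_right_zero exp_add add: algebra_simps)
  also have "\<dots> \<le> ?Ex (\<lambda>y. exp (l * (g y - ?Ex g)) * exp (l\<^sup>2 * ?S / 8))"
    using IH by (intro integral_mono_AE int) (auto simp: AE_measure_pmf_iff)
  also have "\<dots> \<le> exp (l\<^sup>2 * (c x)\<^sup>2 / 8) * exp (l\<^sup>2 * ?S / 8)"
    using H by simp
  also have "\<dots> = exp (l\<^sup>2 * (\<Sum>k\<in>insert x A. (c k)\<^sup>2) / 8)"
    using insert by (simp flip: exp_add add: algebra_simps add_divide_distrib)
  finally show ?case
    unfolding Ef g_def .
qed

text \<open>Chernoff's method: Markov's inequality for the exponential moment. The constant
  \<open>C\<close> may be any positive upper bound of the sum of squares, since the application only
  estimates that sum.\<close>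

lemma McDiarmid_inequality:
  fixes f :: "('i \<Rightarrow> 'b) \<Rightarrow> real" and c :: "'i \<Rightarrow> real"
  assumes "finite I" "\<And>k. k \<in> I \<Longrightarrow> finite (set_pmf (p k))"
    and "\<And>k w y. k \<in> I \<Longrightarrow> w \<in> set_pmf (Pi_pmf I d p) \<Longrightarrow> y \<in> set_pmf (p k) \<Longrightarrow>
      \<bar>f w - f (w(k := y))\<bar> \<le> c k"
    and C: "(\<Sum>k\<in>I. (c k)\<^sup>2) \<le> C" "0 < C" and t: "0 < t"
  shows "measure_pmf.prob (Pi_pmf I d p)
      {w. f w \<ge> measure_pmf.expectation (Pi_pmf I d p) f + t} \<le> exp (- 2 * t\<^sup>2 / C)"
proof -
  let ?M = "Pi_pmf I d p"
  let ?E = "measure_pmf.expectation ?M"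
  \<comment> \<open>This value minimises the final exponent
    \<open>l^2 * C / 8 - l * t\<close>.\<close>
  define l where "l = 4 * t / C"
  have l: "0 < l" using C t by (simp add: l_def)
  have fin: "finite (set_pmf ?M)"
    using assms by (intro finite_set_Pi_pmf)
  have "{w. f w \<ge> ?E f + t} = {w \<in> space (measure_pmf ?M). exp (l * (f w - ?E f)) \<ge> exp (l * t)}"
    using l by auto
  also have "measure_pmf.prob ?M \<dots> \<le> ?E (\<lambda>w. exp (l * (f w - ?E f))) / exp (l * t)"
    by (intro integral_Markov_inequality_measure[where A = "{}"] integrable_measure_pmf_finite fin) auto
  also have "\<dots> \<le> exp (l\<^sup>2 * (\<Sum>k\<in>I. (c k)\<^sup>2) / 8) / exp (l * t)"
    using assms(1-3) l by (intro divide_right_mono bounded_differences_mgf) auto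
  also have "\<dots> \<le> exp (l\<^sup>2 * C / 8) / exp (l * t)"
    using C by (intro divide_right_mono) (auto simp: mult_left_mono)
  also have "\<dots> = exp (l\<^sup>2 * C / 8 - l * t)"
    by (simp add: exp_diff)
  also have "l\<^sup>2 * C / 8 - l * t = - 2 * t\<^sup>2 / C"
    using C by (simp add: l_def power2_eq_square field_simps)
  finally show ?thesis .
qed

text \<open>Orthogonality of independent centred vectors. Centring is phrased through inner products
  because the Bochner integral requires a second countable range, which a general Hilbert space
  lacks.\<close>

lemma expectation_norm_sum_Pi_pmf:
  fixes X :: "'i \<Rightarrow> 'b \<Rightarrow> 'a::real_inner"
  assumes "finite I" "\<And>k. k \<in> I \<Longrightarrow> finite (set_pmf (p k))"
    and "\<And>k v. k \<in> I \<Longrightarrow> measure_pmf.expectation (p k) (\<lambda>y. v \<bullet> X k y) = 0"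
  shows "measure_pmf.expectation (Pi_pmf I d p) (\<lambda>w. (norm (v + (\<Sum>k\<in>I. X k (w k))))\<^sup>2)
    = (norm v)\<^sup>2 + (\<Sum>k\<in>I. measure_pmf.expectation (p k) (\<lambda>y. (norm (X k y))\<^sup>2))"
  using assms
proof (induction I arbitrary: v rule: finite_induct)
  case empty
  then show ?case by simp
next
  case (insert x A)
  let ?E = "measure_pmf.expectation (Pi_pmf A d p)"
  let ?Ex = "measure_pmf.expectation (p x)"
  let ?V = "\<Sum>k\<in>A. measure_pmf.expectation (p k) (\<lambda>y. (norm (X k y))\<^sup>2)"
  have int: "integrable (measure_pmf (p x)) h" for h :: "_ \<Rightarrow> real"
    using insert by (auto intro: integrable_measure_pmf_finite)
  have upd: "(\<Sum>k\<in>insert x A. X k ((w(x := y)) k)) = X x y + (\<Sum>k\<in>A. X k (w k))" for w y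
    using insert by (auto intro!: sum.cong)
  have "measure_pmf.expectation (Pi_pmf (insert x A) d p) (\<lambda>w. (norm (v + (\<Sum>k\<in>insert x A. X k (w k))))\<^sup>2)
      = ?Ex (\<lambda>y. ?E (\<lambda>w. (norm (v + (\<Sum>k\<in>insert x A. X k ((w(x := y)) k))))\<^sup>2))"
    using insert by (intro expectation_Pi_pmf_insert) auto
  also have "\<dots> = ?Ex (\<lambda>y. ?E (\<lambda>w. (norm ((v + X x y) + (\<Sum>k\<in>A. X k (w k))))\<^sup>2))"
    unfolding upd by (simp only: add.assoc)
  also have "\<dots> = ?Ex (\<lambda>y. (norm (v + X x y))\<^sup>2 + ?V)"
    using insert by simp
  also have "\<dots> = ?Ex (\<lambda>y. (norm v)\<^sup>2 + ?V + 2 * (v \<bullet> X x y) + (norm (X x y))\<^sup>2)"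
    by (simp add: power2_norm_eq_inner algebra_simps inner_commute)
  \<comment> \<open>The cross term vanishes by centring, tested against \<open>v\<close>
    itself.\<close>
  also have "\<dots> = (norm v)\<^sup>2 + ?V + ?Ex (\<lambda>y. (norm (X x y))\<^sup>2)"
    using insert.prems(2)[of x v] by (simp add: int)
  finally show ?case using insert by simp
qed


subsection \<open>The sampling construction\<close>

locale weighted_partition =
  fixes S :: "'a::real_inner set" and m :: nat and P :: "nat \<Rightarrow> 'a set"
    and \<alpha> :: "'a \<Rightarrow> real" and \<omega>s :: 'a
  assumes finite_S: "finite S"
    and partition: "partition_on S (P ` {1..m})" and inj_P: "inj_on P {1..m}"
    and weights: "weight_function S \<alpha> \<omega>s"
begin

abbreviation mass :: "nat \<Rightarrow> real" where "mass i \<equiv> sum \<alpha> (P i)"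
abbreviation size :: "nat \<Rightarrow> nat" where "size i \<equiv> sample_size \<alpha> m (P i)"
abbreviation diam :: real where "diam \<equiv> max_diameter m P"

definition index :: "(nat \<times> nat) set" where
  "index = (SIGMA i:{1..m}. {1..size i})"

text \<open>The weight that a single draw receives in the combined point.\<close>

definition coeff :: "nat \<times> nat \<Rightarrow> real" where
  "coeff k = mass (fst k) / size (fst k)"

text \<open>For positive mass, the mean of one draw from the part; for mass zero, division by zero
  makes it \<open>0\<close>.\<close>

definition centre :: "nat \<Rightarrow> 'a" where
  "centre i = (1 / mass i) *\<^sub>R (\<Sum>\<omega>\<in>P i. \<alpha> \<omega> *\<^sub>R \<omega>)"

definition deviation :: "nat \<times> nat \<Rightarrow> 'a \<Rightarrow> 'a" where
  "deviation k y = coeff k *\<^sub>R (y - centre (fst k))"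

section \<open>Masses, sample sizes and coefficients\<close>

lemma part_subset: "i \<in> {1..m} \<Longrightarrow> P i \<subseteq> S"
  using partition by (auto simp: partition_on_def)

lemma finite_part: "i \<in> {1..m} \<Longrightarrow> finite (P i)"
  using part_subset finite_S finite_subset by blast

lemma weight_nonneg: "i \<in> {1..m} \<Longrightarrow> \<omega> \<in> P i \<Longrightarrow> 0 \<le> \<alpha> \<omega>"
  using weights part_subset by (auto simp: weight_function_def)

lemma mass_nonneg: "i \<in> {1..m} \<Longrightarrow> 0 \<le> mass i"
  by (intro sum_nonneg weight_nonneg)

lemma sum_parts: "(\<Sum>\<omega>\<in>S. h \<omega>) = (\<Sum>i=1..m. \<Sum>\<omega>\<in>P i. h \<omega>)"
proof -
  have S: "S = (\<Union>i\<in>{1..m}. P i)"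
    using partition by (auto simp: partition_on_def)
  have disj: "P i \<inter> P j = {}" if "i \<in> {1..m}" "j \<in> {1..m}" "i \<noteq> j" for i j
  proof (rule disjointD)
    show "disjoint (P ` {1..m})" using partition by (simp add: partition_on_def)
    \<comment> \<open>A partition separates only distinct blocks; injectivity turns distinct indices
      into distinct blocks.\<close>
    show "P i \<noteq> P j" using inj_P that by (meson inj_onD)
  qed (use that in auto)
  show ?thesis
    by (subst S, rule sum.UNION_disjoint) (use finite_part disj in blast)+
qed

lemma sum_mass: "(\<Sum>i=1..m. mass i) = 1"
  using weights sum_parts[of \<alpha>] by (simp add: weight_function_def)

text \<open>For \<open>m = 0\<close> the masses would have the empty sum \<open>0\<close> instead of
  \<open>1\<close>.\<close>

lemma m_pos: "0 < m"
  using sum_mass by (cases m) auto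

lemma size_bounds:
  assumes "i \<in> {1..m}"
  shows "mass i * m \<le> size i" "size i \<le> mass i * m + 1"
proof -
  have "0 \<le> mass i * m" using mass_nonneg[OF assms] by simp
  then have "real (size i) = real_of_int \<lceil>mass i * m\<rceil>"
    by (simp add: sample_size_def)
  then show "mass i * m \<le> size i" "size i \<le> mass i * m + 1"
    by linarith+
qed

lemma mass_eq_0: "i \<in> {1..m} \<Longrightarrow> size i = 0 \<Longrightarrow> mass i = 0"
  using size_bounds(1)[of i] mass_nonneg[of i] m_pos by (auto simp: mult_le_0_iff)

text \<open>A draw exists only if the sample size is nonzero, so division by the mass is legitimate
  on \<open>index\<close>.\<close>

lemma mass_pos:
  assumes "k \<in> index"
  shows "0 < mass (fst k)"
proof -
  have k: "fst k \<in> {1..m}" "0 < size (fst k)" using assms by (auto simp: index_def)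
  have "mass (fst k) \<noteq> 0"
    using k by (auto simp: sample_size_def)
  then show ?thesis using mass_nonneg[OF k(1)] by linarith
qed

lemma fst_index: "k \<in> index \<Longrightarrow> fst k \<in> {1..m}"
  by (auto simp: index_def)

lemma finite_index: "finite index"
  by (simp add: index_def)

lemma sum_index: "(\<Sum>k\<in>index. h k) = (\<Sum>i=1..m. \<Sum>j=1..size i. h (i, j))"
  by (simp add: index_def sum.Sigma)

text \<open>Each part contributes \<open>size i\<close> equal terms that restore its mass; a part
  without draws has mass zero and drops out on both sides.\<close>

lemma sum_coeff_scaleR:
  fixes h :: "nat \<Rightarrow> 'v::real_vector"
  shows "(\<Sum>k\<in>index. coeff k *\<^sub>R h (fst k)) = (\<Sum>i=1..m. mass i *\<^sub>R h i)"
  unfolding sum_index coeff_def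
  by (intro sum.cong) (auto simp: mass_eq_0 sum_constant_scaleR)

lemma coeff_nonneg: "k \<in> index \<Longrightarrow> 0 \<le> coeff k"
  using mass_pos[of k] by (simp add: coeff_def)

lemma sum_coeff: "(\<Sum>k\<in>index. coeff k) = 1"
  using sum_coeff_scaleR[of "\<lambda>_. 1::real"] sum_mass by simp

text \<open>Rounding the sample sizes up makes every coefficient at most \<open>1 / m\<close>.
  Bounding one factor of each square by this leaves the coefficients, which sum to
  \<open>1\<close>.\<close>

lemma sum_coeff_squared: "(\<Sum>k\<in>index. (coeff k)\<^sup>2) \<le> 1 / m"
proof -
  have "(coeff k)\<^sup>2 \<le> coeff k * (1 / m)" if k: "k \<in> index" for k
  proof -
    have "0 < size (fst k)" using k by (auto simp: index_def)
    then have "coeff k \<le> 1 / m"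
      using size_bounds(1)[OF fst_index[OF k]] m_pos by (simp add: coeff_def field_simps)
    then show ?thesis
      unfolding power2_eq_square using coeff_nonneg[OF k] by (rule mult_left_mono)
  qed
  then have "(\<Sum>k\<in>index. (coeff k)\<^sup>2) \<le> (\<Sum>k\<in>index. coeff k * (1 / m))"
    by (rule sum_mono)
  also have "\<dots> = 1 / m"
    using sum_coeff by (simp flip: sum_divide_distrib)
  finally show ?thesis .
qed

lemma combined_point_eq: "combined_point \<alpha> m P w = (\<Sum>k\<in>index. coeff k *\<^sub>R w k)"
  unfolding sum_index combined_point_def part_mean_def coeff_def
  by (simp add: scaleR_right.sum)

lemma mass_centre:
  assumes "i \<in> {1..m}"
  shows "mass i *\<^sub>R centre i = (\<Sum>\<omega>\<in>P i. \<alpha> \<omega> *\<^sub>R \<omega>)"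
proof (cases "mass i = 0")
  case True
  then have "\<forall>\<omega>\<in>P i. \<alpha> \<omega> = 0"
    using assms finite_part weight_nonneg by (subst (asm) sum_nonneg_eq_0_iff) auto
  then show ?thesis using True by simp
qed (simp add: centre_def)

text \<open>Indexing the target by the draws lets the error split draw by draw.\<close>

lemma target_eq: "\<omega>s = (\<Sum>k\<in>index. coeff k *\<^sub>R centre (fst k))"
  using weights by (simp add: weight_function_def sum_parts sum_coeff_scaleR mass_centre)

lemma error_eq: "combined_point \<alpha> m P w - \<omega>s = (\<Sum>k\<in>index. deviation k (w k))"
  by (subst target_eq) (simp add: combined_point_eq deviation_def scaleR_diff_right sum_subtractf)

section \<open>The law of the draws\<close>

abbreviation draw :: "nat \<times> nat \<Rightarrow> 'a pmf" where
  "draw k \<equiv> draw_pmf \<alpha> (P (fst k))"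

lemma pmf_draw:
  assumes "k \<in> index"
  shows "pmf (draw k) \<omega> = (if \<omega> \<in> P (fst k) then \<alpha> \<omega> / mass (fst k) else 0)"
  using mass_pos[OF assms] finite_part weight_nonneg fst_index[OF assms] by (intro pmf_draw_pmf) auto

lemma set_draw:
  assumes "k \<in> index"
  shows "set_pmf (draw k) \<subseteq> P (fst k)"
  using pmf_draw[OF assms] by (auto simp: set_pmf_eq split: if_splits)

lemma finite_draw: "k \<in> index \<Longrightarrow> finite (set_pmf (draw k))"
  using set_draw finite_part fst_index finite_subset by metis

lemma draws_pmf_eq: "draws_pmf \<alpha> m P = Pi_pmf index 0 draw"
  unfolding draws_pmf_def index_def by (simp add: case_prod_unfold)

lemma draws_in_part:
  "w \<in> set_pmf (Pi_pmf index 0 draw) \<Longrightarrow> k \<in> index \<Longrightarrow> w k \<in> P (fst k)"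
  using set_draw[of k] by (cases k) (auto simp: set_Pi_pmf finite_index PiE_dflt_def)

section \<open>Sparsity\<close>

text \<open>There are at most as many weighted points as draws. Rounding up costs at most one draw
  per part, so there are at most \<open>m + m\<close> draws.\<close>

lemma sparse_combined_point:
  assumes "w \<in> set_pmf (Pi_pmf index 0 draw)"
  shows "at_most_sparse (2 * m) S (combined_point \<alpha> m P w)"
proof -
  \<comment> \<open>Draws with replacement may repeat a point, whose coefficients are then
    added.\<close>
  define \<beta> where "\<beta> \<omega> = (\<Sum>k\<in>index. if w k = \<omega> then coeff k else 0)" for \<omega>
  have wS: "w k \<in> S" if "k \<in> index" for k
    using draws_in_part[OF assms that] part_subset[OF fst_index[OF that]] by blast
  have "(\<Sum>\<omega>\<in>S. \<beta> \<omega>) = 1"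
    unfolding \<beta>_def using finite_S wS by (subst sum.swap) (simp add: sum_coeff)
  moreover have "(\<Sum>\<omega>\<in>S. \<beta> \<omega> *\<^sub>R \<omega>) = combined_point \<alpha> m P w"
  proof -
    have "(\<Sum>\<omega>\<in>S. \<beta> \<omega> *\<^sub>R \<omega>) = (\<Sum>\<omega>\<in>S. \<Sum>k\<in>index. if w k = \<omega> then coeff k *\<^sub>R \<omega> else 0)"
      unfolding \<beta>_def scaleR_left.sum by (intro sum.cong) auto
    also have "\<dots> = combined_point \<alpha> m P w"
      using finite_S wS by (subst sum.swap) (simp add: combined_point_eq)
    finally show ?thesis .
  qed
  moreover have "0 \<le> \<beta> \<omega>" for \<omega>
    unfolding \<beta>_def by (intro sum_nonneg) (auto simp: coeff_nonneg)
  ultimately have \<beta>: "weight_function S \<beta> (combined_point \<alpha> m P w)"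
    by (simp add: weight_function_def)
  have "{\<omega> \<in> S. \<beta> \<omega> \<noteq> 0} \<subseteq> w ` index"
    unfolding \<beta>_def by (auto elim!: sum.not_neutral_contains_not_neutral split: if_splits)
  then have "card {\<omega> \<in> S. \<beta> \<omega> \<noteq> 0} \<le> card index"
    by (meson card_image_le card_mono finite_imageI finite_index order_trans)
  moreover have "card index \<le> 2 * m"
  proof -
    have "real (card index) = (\<Sum>i=1..m. real (size i))"
      by (simp add: index_def card_SigmaI)
    also have "\<dots> \<le> (\<Sum>i=1..m. mass i * m + 1)"
      by (intro sum_mono size_bounds)
    also have "\<dots> = real (2 * m)"
      using sum_mass by (simp add: sum.distrib flip: sum_distrib_right)
    finally show ?thesis by linarith
  qed
  ultimately show ?thesis
    using \<beta> convex_hull_iff_weight_function[OF finite_S] by (auto simp: at_most_sparse_def)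
qed

section \<open>Size and centring of single deviations\<close>

text \<open>Finiteness of the parts and of the index range bounds both suprema, as conditional
  completeness demands.\<close>

lemma norm_diff_le_diam:
  assumes "i \<in> {1..m}" "x \<in> P i" "y \<in> P i"
  shows "norm (x - y) \<le> diam"
proof -
  have "norm (x - y) \<le> (SUP (\<omega>, \<omega>')\<in>P i \<times> P i. norm (\<omega> - \<omega>'))"
    using cSUP_upper[of "(x, y)" "P i \<times> P i" "\<lambda>(\<omega>, \<omega>'). norm (\<omega> - \<omega>')"] finite_part assms by simp
  also have "\<dots> \<le> diam"
    unfolding max_diameter_def using assms(1) by (intro cSUP_upper) auto
  finally show ?thesis .
qed

text \<open>The centre is a weighted average of points of the part, each within \<open>diam\<close>
  of \<open>y\<close>.\<close>

lemma norm_deviation_le: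
  assumes "k \<in> index" "y \<in> P (fst k)"
  shows "norm (deviation k y) \<le> coeff k * diam"
proof -
  let ?i = "fst k"
  note i = fst_index[OF assms(1)] and pos = mass_pos[OF assms(1)]
  have "mass ?i *\<^sub>R (y - centre ?i) = (\<Sum>\<omega>\<in>P ?i. \<alpha> \<omega> *\<^sub>R (y - \<omega>))"
    using mass_centre[OF i] by (simp add: scaleR_diff_right sum_subtractf flip: scaleR_left.sum)
  then have "mass ?i * norm (y - centre ?i) = norm (\<Sum>\<omega>\<in>P ?i. \<alpha> \<omega> *\<^sub>R (y - \<omega>))"
    using pos by (metis abs_of_pos norm_scaleR)
  also have "\<dots> \<le> (\<Sum>\<omega>\<in>P ?i. \<alpha> \<omega> * diam)"
    using weight_nonneg[OF i] norm_diff_le_diam[OF i assms(2)]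
    by (intro sum_norm_le) (auto intro: mult_left_mono)
  finally have "norm (y - centre ?i) \<le> diam"
    using pos by (simp flip: sum_distrib_right)
  then show ?thesis
    using coeff_nonneg[OF assms(1)] by (simp add: deviation_def mult_left_mono)
qed

text \<open>The draw probabilities are the weights that define the centre, so the weighted
  deviations cancel.\<close>

lemma expectation_inner_deviation:
  assumes "k \<in> index"
  shows "measure_pmf.expectation (draw k) (\<lambda>y. v \<bullet> deviation k y) = 0"
proof -
  let ?i = "fst k"
  note i = fst_index[OF assms]
  have "measure_pmf.expectation (draw k) (\<lambda>y. v \<bullet> deviation k y)
      = (\<Sum>y\<in>P ?i. (\<alpha> y / mass ?i) * (v \<bullet> deviation k y))"
    using finite_part[OF i] set_draw[OF assms] pmf_draw[OF assms]
    by (subst integral_measure_pmf[of "P ?i"]) auto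
  also have "\<dots> = (coeff k / mass ?i) * (v \<bullet> (\<Sum>y\<in>P ?i. \<alpha> y *\<^sub>R (y - centre ?i)))"
    by (simp add: deviation_def inner_sum_right sum_distrib_left mult_ac)
  also have "(\<Sum>y\<in>P ?i. \<alpha> y *\<^sub>R (y - centre ?i)) = 0"
    using mass_centre[OF i] by (simp add: scaleR_diff_right sum_subtractf flip: scaleR_left.sum)
  finally show ?thesis by simp
qed

section \<open>Mean and tail of the error\<close>

definition error :: "(nat \<times> nat \<Rightarrow> 'a) \<Rightarrow> real" where
  "error w = norm (\<Sum>k\<in>index. deviation k (w k))"

text \<open>Blocks of a partition are nonempty, so some point can be compared with itself.\<close>

lemma diam_nonneg: "0 \<le> diam"
proof -
  have "1 \<in> {1..m}" using m_pos by auto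
  moreover from this obtain x where "x \<in> P 1"
    using partition by (force simp: partition_on_def)
  ultimately show ?thesis
    using norm_diff_le_diam[of 1 x x] by simp
qed

text \<open>Serves twice: for the second moment and as the constant in McDiarmid's
  inequality.\<close>

lemma sum_coeff_diam_squared: "(\<Sum>k\<in>index. (coeff k * diam)\<^sup>2) \<le> diam\<^sup>2 / m"
  using mult_right_mono[OF sum_coeff_squared, of "diam\<^sup>2"]
  by (simp add: power_mult_distrib flip: sum_distrib_right)

lemma expectation_error_le:
  "measure_pmf.expectation (Pi_pmf index 0 draw) error \<le> diam / sqrt m"
proof -
  let ?M = "Pi_pmf index 0 draw"
  have int: "integrable (measure_pmf ?M) h" for h :: "_ \<Rightarrow> real"
    by (intro integrable_measure_pmf_finite finite_set_Pi_pmf finite_index finite_draw)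
  \<comment> \<open>Nonnegative variance gives Jensen's inequality for the square.\<close>
  have "0 \<le> measure_pmf.variance ?M error"
    by simp
  then have "(measure_pmf.expectation ?M error)\<^sup>2 \<le> measure_pmf.expectation ?M (\<lambda>w. (error w)\<^sup>2)"
    by (subst (asm) measure_pmf.variance_eq) (auto intro: int)
  also have "\<dots> = (\<Sum>k\<in>index. measure_pmf.expectation (draw k) (\<lambda>y. (norm (deviation k y))\<^sup>2))"
    unfolding error_def
    using expectation_norm_sum_Pi_pmf[of index draw deviation 0 0]
      finite_index finite_draw expectation_inner_deviation by simp
  also have "\<dots> \<le> (\<Sum>k\<in>index. (coeff k * diam)\<^sup>2)"
  proof (rule sum_mono)
    fix k assume k: "k \<in> index"
    have "measure_pmf.expectation (draw k) (\<lambda>y. (norm (deviation k y))\<^sup>2)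
        \<le> measure_pmf.expectation (draw k) (\<lambda>_. (coeff k * diam)\<^sup>2)"
      using set_draw[OF k] norm_deviation_le[OF k]
      by (intro integral_mono_AE integrable_measure_pmf_finite finite_draw k)
         (auto simp: AE_measure_pmf_iff intro!: power_mono)
    then show "measure_pmf.expectation (draw k) (\<lambda>y. (norm (deviation k y))\<^sup>2) \<le> (coeff k * diam)\<^sup>2"
      by simp
  qed
  also have "\<dots> \<le> (diam / sqrt m)\<^sup>2"
    using sum_coeff_diam_squared by (simp add: power_divide)
  finally show ?thesis
    using diam_nonneg by (auto intro: power2_le_imp_le)
qed

text \<open>The centre cancels when one draw is replaced, so two points of the same part are
  compared and no factor \<open>2\<close> arises.\<close>

lemma error_bounded_difference:
  assumes "k \<in> index" "w \<in> set_pmf (Pi_pmf index 0 draw)" "y \<in> set_pmf (draw k)"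
  shows "\<bar>error w - error (w(k := y))\<bar> \<le> coeff k * diam"
proof -
  have "(\<Sum>l\<in>index. deviation l (w l)) - (\<Sum>l\<in>index. deviation l ((w(k := y)) l))
      = (\<Sum>l\<in>index. if l = k then coeff k *\<^sub>R (w k - y) else 0)"
    unfolding sum_subtractf[symmetric]
    by (intro sum.cong) (auto simp: deviation_def simp flip: scaleR_diff_right)
  also have "\<dots> = coeff k *\<^sub>R (w k - y)"
    using assms finite_index by simp
  finally have "\<bar>error w - error (w(k := y))\<bar> \<le> norm (coeff k *\<^sub>R (w k - y))"
    unfolding error_def by (metis norm_triangle_ineq3)
  also have "\<dots> \<le> coeff k * diam"
    using coeff_nonneg[OF assms(1)] norm_diff_le_diam[OF fst_index[OF assms(1)]]
      draws_in_part[OF assms(2,1)] set_draw[OF assms(1)] assms(3) by (auto intro!: mult_left_mono)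
  finally show ?thesis .
qed

lemma prob_error_le:
  fixes \<delta> :: real
  assumes "0 < \<delta>" "\<delta> < 1"
  shows "1 - \<delta> \<le> measure_pmf.prob (Pi_pmf index 0 draw)
    {w. error w \<le> diam * (1 / sqrt m + sqrt (ln (1 / \<delta>) / m))}"
\<comment> \<open>McDiarmid's inequality needs a positive constant. For diameter zero every
  deviation vanishes on the support.\<close>
proof (cases "diam = 0")
  case True
  have "error w = 0" if w: "w \<in> set_pmf (Pi_pmf index 0 draw)" for w
  proof -
    have "deviation k (w k) = 0" if k: "k \<in> index" for k
      using norm_deviation_le[OF k draws_in_part[OF w k]] unfolding True by simp
    then have "(\<Sum>k\<in>index. deviation k (w k)) = 0"
      by (intro sum.neutral) blast
    then show ?thesis unfolding error_def by (simp only: norm_zero)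
  qed
  then have "measure_pmf.prob (Pi_pmf index 0 draw)
      {w. error w \<le> diam * (1 / sqrt m + sqrt (ln (1 / \<delta>) / m))} = 1"
    by (subst measure_pmf.prob_eq_1) (simp_all add: True AE_measure_pmf_iff)
  then show ?thesis using assms by simp
next
  case False
  let ?M = "Pi_pmf index 0 draw"
  \<comment> \<open>The part of the radius left for fluctuation; the other part,
    \<open>diam / sqrt m\<close>, dominates the mean.\<close>
  define t where "t = diam * sqrt (ln (1 / \<delta>) / m)"
  have D: "0 < diam" using diam_nonneg False by simp
  have ln: "0 < ln (1 / \<delta>)" using assms by simp
  have t: "0 < t" unfolding t_def using D ln m_pos by simp
  let ?G = "{w. error w \<le> diam * (1 / sqrt m + sqrt (ln (1 / \<delta>) / m))}"
  have "UNIV - ?G \<subseteq> {w. error w \<ge> measure_pmf.expectation ?M error + t}"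
  proof
    fix w assume "w \<in> UNIV - ?G"
    then have "diam / sqrt m + t < error w"
      by (simp add: t_def distrib_left not_le)
    then show "w \<in> {w. error w \<ge> measure_pmf.expectation ?M error + t}"
      using expectation_error_le by simp
  qed
  then have "measure_pmf.prob ?M (UNIV - ?G)
      \<le> measure_pmf.prob ?M {w. error w \<ge> measure_pmf.expectation ?M error + t}"
    by (intro measure_pmf.finite_measure_mono) simp_all
  also have "\<dots> \<le> exp (- 2 * t\<^sup>2 / (diam\<^sup>2 / m))"
  proof (rule McDiarmid_inequality[OF finite_index finite_draw error_bounded_difference
        sum_coeff_diam_squared _ t])
    show "0 < diam\<^sup>2 / m" using D m_pos by simp
  qed
  also have "t\<^sup>2 = diam\<^sup>2 * (ln (1 / \<delta>) / m)"
    using ln by (simp add: t_def power_mult_distrib)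
  also have "- 2 * (diam\<^sup>2 * (ln (1 / \<delta>) / m)) / (diam\<^sup>2 / m) = - 2 * ln (1 / \<delta>)"
    using D m_pos by simp
  \<comment> \<open>The failure bound is in fact the square of \<delta>; it is weakened to
    \<delta>.\<close>
  also have "exp (- 2 * ln (1 / \<delta>)) \<le> exp (- ln (1 / \<delta>))"
    using ln by simp
  also have "\<dots> = \<delta>"
    using assms(1) by (simp add: ln_div)
  finally have "measure_pmf.prob ?M (UNIV - ?G) \<le> \<delta>" .
  moreover have "measure_pmf.prob ?M (UNIV - ?G) = 1 - measure_pmf.prob ?M ?G"
    using measure_pmf.prob_compl[of ?G ?M] by simp
  ultimately show ?thesis by linarith
qed

end

theorem theorem21:
  fixes S :: "'a::{real_inner, complete_space} set"
    and m :: nat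
    and P :: "nat \<Rightarrow> 'a set"
    and \<alpha> :: "'a \<Rightarrow> real"
    and \<omega>s :: 'a
  assumes "finite S"
    and "partition_on S (P ` {1..m})" and "inj_on P {1..m}"
    and "weight_function S \<alpha> \<omega>s"
  shows "(\<forall>\<omega>t \<in> set_pmf (random_point \<alpha> m P). at_most_sparse (2 * m) S \<omega>t) \<and>
    (\<forall>\<delta>::real. 0 < \<delta> \<and> \<delta> < 1 \<longrightarrow>
      measure_pmf.prob (random_point \<alpha> m P)
        {\<omega>t. norm (\<omega>s - \<omega>t)
          \<le> max_diameter m P * (1 / sqrt (real m) + sqrt (ln (1 / \<delta>) / real m))}
      \<ge> 1 - \<delta>)"
proof -
  interpret weighted_partition S m P \<alpha> \<omega>s
    using assms by unfold_locales
  have "norm (\<omega>s - combined_point \<alpha> m P w) = error w" for w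
    by (simp add: error_def norm_minus_commute flip: error_eq)
  \<comment> \<open>Both claims about \<open>random_point\<close> pull back along
    \<open>map_pmf\<close> to the product of the draws.\<close>
  then show ?thesis
    using sparse_combined_point prob_error_le
    by (simp add: random_point_def draws_pmf_eq vimage_def)
qed

end
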